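(* Let $I$ be a finite set of items, let $s(i)$ be a positive integer size for each $i\in I$, and let $f\colon 2^I\to\mathbb{R}_+$ be monotone and submodular with $f(\emptyset)=0$. Consider the randomized adaptive policy (with cancellation, unknown capacity) that executes the policy $\mathcal{P}^1$ for $(I,\emptyset)$ with probability $1/2$ and the policy $\mathcal{P}^2$ with probability $1/2$. This randomized adaptive policy is $\frac{1}{2}\left(1-\frac1e\right)$-robust (where $\frac12(1-\frac1e)>0.316$); that is, for every capacity $C\in\mathbb{R}_+$, $$\frac{f(\mathcal{P}^1(C))+f(\mathcal{P}^2(C))}{2}\ \ge\ \frac{1}{2}\left(1-\frac1e\right) f(\mathrm{OPT}_C).$$
   Context: Problem (submodular maximization with unknown knapsack capacity, with cancellation): the capacity $C$ is unknown. Items are tried one at a time, each at most once. When item $i$ is tried and the current knapsack content is $X$, we learn whether $i$ fits, i.e. whether $s(X)+s(i)\le C$, where $s(X)=\sum_{j\in X}s(j)$. If it fits, $i$ is irrevocably added to $X$; otherwise $i$ is discarded and the process continues with the remaining items. An adaptive policy $\mathcal{P}$ is a binary decision tree specifying the next item to try depending on the observations so far; a randomized policy is a probability distribution over such trees. $\mathcal{P}(C)$ denotes the final content of the knapsack when the capacity is $C$. $\mathrm{OPT}_C$ denotes a set maximizing $f(X)$ over $X\subseteq I$ with $s(X)\le C$. A randomized policy is $\alpha$-robust if for every $C\in\mathbb{R}_+$ the expected value of $f$ on its output is at least $\alpha f(\mathrm{OPT}_C)$. Policy $\mathcal{P}^1$ for $(I,U)$, where $U\subseteq I$: start with $X=U$,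 $R=I\setminus U$. For $j=1,\dots,|I\setminus U|$: choose $i_j\in\arg\max\{(f(X\cup\{i\})-f(X))/s(i)\colon i\in R\}$ (ties broken arbitrarily); if $s(X)+s(i_j)\le C$ then set $X\leftarrow X\cup\{i_j\}$, otherwise discard $i_j$; set $R\leftarrow R\setminus\{i_j\}$. Output $X$. Policy $\mathcal{P}^2$: start with $X=\emptyset$, $R=I$. For $j=1,\dots,|I|$: choose $i_j\in\arg\max\{f(X\cup\{i\})-f(X)\colon i\in R\}$ (ties broken arbitrarily); if $s(X)+s(i_j)\le C$ then set $X\leftarrow X\cup\{i_j\}$, otherwise discard $i_j$; set $R\leftarrow R\setminus\{i_j\}$. Output $X$. *)

theory Defs
  imports "HOL-Probability.Probability_Mass_Function"
begin

definition submodular_on :: "'a set \<Rightarrow> ('a set \<Rightarrow> real) \<Rightarrow> bool" where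
  "submodular_on I f \<longleftrightarrow>
    (\<forall>X Y. X \<subseteq> I \<longrightarrow> Y \<subseteq> I \<longrightarrow> f (X \<union> Y) + f (X \<inter> Y) \<le> f X + f Y)"

text \<open>A policy is a binary decision tree: \<open>Try i l r\<close> tries item \<open>i\<close> and continues with \<open>l\<close>
  if \<open>i\<close> fits (and is packed) and with \<open>r\<close> if it does not fit (and is discarded).\<close>

datatype 'a policy = Stop | Try 'a "'a policy" "'a policy"

text \<open>On every branch only items of the given set are tried, each at most once.\<close>

primrec adaptive_policy :: "'a set \<Rightarrow> 'a policy \<Rightarrow> bool" where
  "adaptive_policy R Stop \<longleftrightarrow> True"
| "adaptive_policy R (Try i l r) \<longleftrightarrow>
    i \<in> R \<and> adaptive_policy (R - {i}) l \<and> adaptive_policy (R - {i}) r"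

definition randomized_policy :: "'a set \<Rightarrow> 'a policy pmf \<Rightarrow> bool" where
  "randomized_policy I p \<longleftrightarrow> (\<forall>t \<in> set_pmf p. adaptive_policy I t)"

text \<open>Final knapsack content for capacity \<open>C\<close>, starting from content \<open>X\<close>.\<close>

primrec run :: "('a \<Rightarrow> nat) \<Rightarrow> real \<Rightarrow> 'a set \<Rightarrow> 'a policy \<Rightarrow> 'a set" where
  "run s C X Stop = X"
| "run s C X (Try i l r) =
    (if real (sum s X) + real (s i) \<le> C then run s C (insert i X) l else run s C X r)"

definition OPT :: "'a set \<Rightarrow> ('a \<Rightarrow> nat) \<Rightarrow> ('a set \<Rightarrow> real) \<Rightarrow> real \<Rightarrow> 'a set" where
  "OPT I s f C = (ARG_MAX f X. X \<subseteq> I \<and> real (sum s X) \<le> C)"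

definition robust ::
    "'a set \<Rightarrow> ('a \<Rightarrow> nat) \<Rightarrow> ('a set \<Rightarrow> real) \<Rightarrow> real \<Rightarrow> 'a policy pmf \<Rightarrow> bool" where
  "robust I s f \<alpha> p \<longleftrightarrow>
    (\<forall>C\<ge>0. measure_pmf.expectation p (\<lambda>t. f (run s C {} t)) \<ge> \<alpha> * f (OPT I s f C))"

text \<open>\<open>greedy_tree g X R t\<close>: with content \<open>X\<close> and remaining items \<open>R\<close>, the tree \<open>t\<close> always tries
  next a remaining item maximizing \<open>g\<close> for the current content, until no item remains.
  Being a relation, it leaves the tie-breaking arbitrary, separately at every node.\<close>

inductive greedy_tree ::
    "('a set \<Rightarrow> 'a \<Rightarrow> real) \<Rightarrow> 'a set \<Rightarrow> 'a set \<Rightarrow> 'a policy \<Rightarrow> bool"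
  for g where
  "greedy_tree g X {} Stop"
| "is_arg_max (g X) (\<lambda>j. j \<in> R) i \<Longrightarrow> greedy_tree g (insert i X) (R - {i}) l \<Longrightarrow>
    greedy_tree g X (R - {i}) r \<Longrightarrow> greedy_tree g X R (Try i l r)"

text \<open>A tree satisfying \<open>policy1 I U s f\<close> is to be run from initial content \<open>U\<close>.\<close>

definition policy1 ::
    "'a set \<Rightarrow> 'a set \<Rightarrow> ('a \<Rightarrow> nat) \<Rightarrow> ('a set \<Rightarrow> real) \<Rightarrow> 'a policy \<Rightarrow> bool" where
  "policy1 I U s f t \<longleftrightarrow> U \<subseteq> I \<and>
    greedy_tree (\<lambda>X i. (f (X \<union> {i}) - f X) / real (s i)) U (I - U) t"

definition policy2 :: "'a set \<Rightarrow> ('a set \<Rightarrow> real) \<Rightarrow> 'a policy \<Rightarrow> bool" where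
  "policy2 I f t \<longleftrightarrow> greedy_tree (\<lambda>X i. f (X \<union> {i}) - f X) {} I t"

definition coin_mix :: "'a policy \<Rightarrow> 'a policy \<Rightarrow> 'a policy pmf" where
  "coin_mix t1 t2 = map_pmf (\<lambda>b. if b then t1 else t2) (bernoulli_pmf (1/2))"

lemma OPT_is_arg_max:
  assumes "finite I" "0 \<le> C"
  shows "is_arg_max f (\<lambda>X. X \<subseteq> I \<and> real (sum s X) \<le> C) (OPT I s f C)"
proof -
  let ?S = "{X. X \<subseteq> I \<and> real (sum s X) \<le> C}"
  have fin: "finite ?S" using assms(1) by simp
  have "{} \<in> ?S" using assms(2) by simp
  then have ne: "?S \<noteq> {}" by blast
  have "Max (f ` ?S) \<in> f ` ?S" by (rule Max_in) (use fin ne in \<open>blast+\<close>)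
  then obtain Y where Y: "Y \<in> ?S" "f Y = Max (f ` ?S)" by (elim imageE) simp
  have "is_arg_max f (\<lambda>X. X \<subseteq> I \<and> real (sum s X) \<le> C) Y"
    unfolding is_arg_max_linorder
  proof (intro conjI allI impI)
    show "Y \<subseteq> I" "real (sum s Y) \<le> C" using Y(1) by blast+
  next
    fix Z assume "Z \<subseteq> I \<and> real (sum s Z) \<le> C"
    then have "f Z \<in> f ` ?S" by blast
    then show "f Z \<le> f Y" unfolding Y(2) by (intro Max_ge finite_imageI fin)
  qed
  then show ?thesis unfolding OPT_def arg_max_def by (rule someI)
qed

lemma greedy_tree_exists:
  assumes "finite R"
  shows "\<exists>t. greedy_tree g X R t"
  using assms
proof (induction R arbitrary: X rule: finite_psubset_induct)
  case (psubset R)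
  show ?case
  proof (cases "R = {}")
    case True
    then show ?thesis using greedy_tree.intros(1) by blast
  next
    case False
    have "Max (g X ` R) \<in> g X ` R" by (rule Max_in) (use psubset.hyps False in \<open>blast+\<close>)
    then obtain i where i: "i \<in> R" "g X i = Max (g X ` R)" by (elim imageE) simp
    have am: "is_arg_max (g X) (\<lambda>j. j \<in> R) i"
      unfolding is_arg_max_linorder using i psubset.hyps by simp
    have sub: "R - {i} \<subset> R" using i(1) by blast
    obtain l where "greedy_tree g (insert i X) (R - {i}) l" using psubset.IH[OF sub] by blast
    moreover obtain r where "greedy_tree g X (R - {i}) r" using psubset.IH[OF sub] by blast
    ultimately have "greedy_tree g X R (Try i l r)"
      by (rule greedy_tree.intros(2)[where g = g and X = X and R = R and i = i, OF am])
    then show ?thesis ..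
  qed
qed

lemma greedy_tree_adaptive_policy:
  "greedy_tree g X R t \<Longrightarrow> adaptive_policy R t"
  by (induction rule: greedy_tree.induct) (auto simp: is_arg_max_def)

end

theory Submission imports Defs begin

text \<open>If the density greedy packs every item of the optimum \<open>T\<close>, it is optimal by itself.
  Otherwise consider the first item \<open>i \<in> T\<close> that it discards, with content \<open>X\<close>. All steps so far
  had every missing item of \<open>T\<close> as a competitor, so the usual greedy analysis gives
  \<open>f T - f X \<le> exp (- s X / C) * f T\<close>, and it also covers the (overflowing) step that adds \<open>i\<close>.
  As \<open>X \<union> {i}\<close> has size more than \<open>C\<close>, this yields \<open>f X + f {i} \<ge> (1 - 1/e) * f T\<close>. The first item
  packed by the second policy is at least as good as \<open>{i}\<close>, because \<open>i\<close> fits on its own.\<close>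

section \<open>Marginal values and final contents\<close>

lemma submodular_on_marginals:
  assumes "submodular_on I f" "X \<subseteq> I" "A \<subseteq> I" "finite A" "A \<inter> X = {}"
  shows "f (X \<union> A) - f X \<le> (\<Sum>a\<in>A. f (X \<union> {a}) - f X)"
  using assms(4,3,5)
proof (induction A rule: finite_induct)
  case (insert a A)
  have "f ((X \<union> A) \<union> (X \<union> {a})) + f ((X \<union> A) \<inter> (X \<union> {a})) \<le> f (X \<union> A) + f (X \<union> {a})"
    by (rule assms(1)[unfolded submodular_on_def, rule_format])
      (use assms(2) insert.prems in auto)
  moreover have "(X \<union> A) \<union> (X \<union> {a}) = X \<union> insert a A" "(X \<union> A) \<inter> (X \<union> {a}) = X"
    using insert.hyps by auto
  moreover have "f (X \<union> A) - f X \<le> (\<Sum>a\<in>A. f (X \<union> {a}) - f X)"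
    by (rule insert.IH) (use insert.prems in auto)
  ultimately show ?case
    using insert.hyps by simp
qed simp

lemma run_superset: "X \<subseteq> run s C X t"
proof (induction t arbitrary: X)
  case (Try i l r)
  have "X \<subseteq> run s C (insert i X) l"
    using Try.IH(1)[of "insert i X"] by blast
  then show ?case
    using Try.IH(2) by simp
qed simp

text \<open>Monotonicity of \<open>f\<close> is available only on subsets of \<open>I\<close>, so
  outputs must be located inside \<open>I\<close> before their values are compared.\<close>

lemma run_subset: "adaptive_policy R t \<Longrightarrow> run s C X t \<subseteq> X \<union> R"
proof (induction t arbitrary: X R)
  case (Try i l r)
  have "run s C (insert i X) l \<subseteq> insert i X \<union> (R - {i})" "run s C X r \<subseteq> X \<union> (R - {i})"
    by (rule Try.IH; use Try.prems in simp)+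
  moreover have "i \<in> R"
    using Try.prems by simp
  ultimately show ?case by auto
qed simp

section \<open>Exponential decay of the gap under the density greedy\<close>

text \<open>The items of \<open>T - X\<close> all lie in \<open>R\<close> and have total size at
  most \<open>C\<close>, so the gap to \<open>f T\<close> is at most \<open>C\<close> times the best
  density. Adding \<open>i\<close> therefore closes at least the fraction \<open>s i / C\<close> of
  it. Whether \<open>i\<close> fits is left open, so the bound also covers the step that
  overflows.\<close>

lemma density_greedy_step:
  fixes s :: "'a \<Rightarrow> nat"
  assumes I: "finite I" "\<forall>i\<in>I. 0 < s i" "mono_on (Pow I) f" "submodular_on I f"
    and C: "0 < C"
    and sets: "X \<subseteq> I" "R \<subseteq> I" "X \<inter> R = {}" "T \<subseteq> X \<union> R" "real (sum s T) \<le> C"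
    and inv: "f T - f X \<le> exp (- real (sum s X) / C) * f T"
    and nonneg: "0 \<le> f T"
    and i: "is_arg_max (\<lambda>i. (f (X \<union> {i}) - f X) / real (s i)) (\<lambda>j. j \<in> R) i"
  shows "f T - f (insert i X) \<le> exp (- real (sum s (insert i X)) / C) * f T"
\<comment> \<open>In the second case the gap at \<open>X\<close> is nonnegative, so 1 - x \<le> exp
  (- x) may be multiplied by it.\<close>
proof (cases "f T \<le> f (insert i X)")
  case True
  have "0 \<le> exp (- real (sum s (insert i X)) / C) * f T"
    using nonneg by simp
  then show ?thesis
    using True by linarith
next
  case False
  define \<rho> where "\<rho> = (f (X \<union> {i}) - f X) / real (s i)"
  have max: "(f (X \<union> {j}) - f X) / real (s j) \<le> \<rho>" if "j \<in> R" for j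
    using i that by (auto simp: is_arg_max_linorder \<rho>_def)
  have iR: "i \<in> R"
    using i by (simp add: is_arg_max_linorder)
  have si: "0 < s i" and iX: "i \<notin> X"
    using I(2) iR sets by auto
  have "X \<union> R \<subseteq> I"
    using sets by blast
  then have "finite (X \<union> R)"
    using I(1) finite_subset by blast
  then have finX: "finite X" and finT: "finite T"
    using sets(4) finite_subset by auto
  have mono: "f A \<le> f B" if "A \<subseteq> B" "B \<subseteq> I" for A B
    using I(3) that by (auto simp: mono_on_def)
  have grow: "f X \<le> f (insert i X)"
    by (rule mono) (use iR sets in auto)
  then have \<rho>: "0 \<le> \<rho>"
    by (simp add: \<rho>_def)
  have "f T - f X \<le> f (X \<union> (T - X)) - f X"
    using mono[of T "X \<union> (T - X)"] sets by auto
  also have "\<dots> \<le> (\<Sum>j\<in>T - X. f (X \<union> {j}) - f X)"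
    by (rule submodular_on_marginals[OF I(4)]) (use sets finT in auto)
  also have "\<dots> \<le> (\<Sum>j\<in>T - X. \<rho> * real (s j))"
  proof (rule sum_mono)
    fix j assume "j \<in> T - X"
    then have "j \<in> R" "0 < s j"
      using sets I(2) by auto
    then show "f (X \<union> {j}) - f X \<le> \<rho> * real (s j)"
      using max[of j] by (simp add: field_simps)
  qed
  also have "\<dots> = \<rho> * real (sum s (T - X))"
    by (simp add: sum_distrib_left)
  also have "\<dots> \<le> \<rho> * real (sum s T)"
    by (intro mult_left_mono of_nat_mono sum_mono2 \<rho> finT) auto
  also have "\<dots> \<le> \<rho> * C"
    by (intro mult_left_mono \<rho> sets)
  finally have gap: "f T - f X \<le> \<rho> * C" .
  define x where "x = real (s i) / C"
  have gain: "f (insert i X) - f X = \<rho> * C * x"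
    using si C by (simp add: \<rho>_def x_def)
  have "0 \<le> x"
    using C by (simp add: x_def)
  have "0 \<le> f T - f X"
    using False grow by linarith
  have "f T - f (insert i X) \<le> (f T - f X) * (1 - x)"
    using gain mult_right_mono[OF gap \<open>0 \<le> x\<close>] by (simp add: algebra_simps)
  also have "\<dots> \<le> (f T - f X) * exp (- x)"
    using exp_ge_add_one_self[of "- x"] \<open>0 \<le> f T - f X\<close> by (intro mult_left_mono) auto
  also have "\<dots> \<le> exp (- real (sum s X) / C) * f T * exp (- x)"
    using inv by (intro mult_right_mono) auto
  also have "\<dots> = exp (- real (sum s X) / C + - x) * f T"
    by (simp only: exp_add mult_ac)
  also have "- real (sum s X) / C + - x = - real (sum s (insert i X)) / C"
    using iX finX by (simp add: x_def add_divide_distrib diff_divide_distrib)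
  finally show ?thesis .
qed

text \<open>The last two assumptions are the invariant up to the first discarded item of
  \<open>T\<close>: nothing of \<open>T\<close> is lost yet, and the gap has decayed. If the tree
  ends first, \<open>R\<close> is empty and \<open>T\<close> is packed; otherwise that item is the
  witness.\<close>

lemma density_greedy_run:
  fixes s :: "'a \<Rightarrow> nat"
  assumes I: "finite I" "\<forall>i\<in>I. 0 < s i" "mono_on (Pow I) f" "submodular_on I f" "f {} = 0"
    and C: "0 < C"
    and T: "real (sum s T) \<le> C" "0 \<le> f T"
    and t: "greedy_tree (\<lambda>X i. (f (X \<union> {i}) - f X) / real (s i)) X R t"
    and "X \<subseteq> I" "R \<subseteq> I" "X \<inter> R = {}" "T \<subseteq> X \<union> R"
    and "f T - f X \<le> exp (- real (sum s X) / C) * f T"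
  shows "T \<subseteq> run s C X t \<or> (\<exists>i\<in>T. (1 - 1 / exp 1) * f T \<le> f (run s C X t) + f {i})"
  using t assms(10-)
proof (induction rule: greedy_tree.induct)
  case (1 X)
  then show ?case by simp
next
  case (2 X R i l r)
  have i: "i \<in> R"
    using 2(1) by (simp add: is_arg_max_linorder)
  have step: "f T - f (insert i X) \<le> exp (- real (sum s (insert i X)) / C) * f T"
    using 2 by (intro density_greedy_step[OF I(1-4) C _ _ _ _ T(1) _ T(2)]) auto
  show ?case
  proof (cases "real (sum s X) + real (s i) \<le> C")
    case True
    have "T \<subseteq> run s C (insert i X) l
        \<or> (\<exists>j\<in>T. (1 - 1 / exp 1) * f T \<le> f (run s C (insert i X) l) + f {j})"
      by (rule 2(4)) (use 2(6-) i step in auto)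
    with True show ?thesis by simp
  next
    case nofit: False
    show ?thesis
    proof (cases "i \<in> T")
      case True
      have "i \<notin> X"
        using i 2(8) by blast
      moreover have "finite X"
        using 2(6) I(1) finite_subset by blast
      \<comment> \<open>The overflow pushes the exponent down to -1 or below; this is the source of
        1/e.\<close>
      ultimately have "C \<le> real (sum s (insert i X))"
        using nofit by simp
      then have "- real (sum s (insert i X)) / C \<le> - 1"
        using C by (simp add: field_simps)
      then have "exp (- real (sum s (insert i X)) / C) * f T \<le> exp (- 1) * f T"
        using T(2) by (intro mult_right_mono) auto
      then have "f T - f (insert i X) \<le> f T / exp 1"
        using step by (simp only: exp_minus divide_inverse mult.commute[of "f T"])
      \<comment> \<open>The infeasible content \<open>insert i X\<close> is split into
        \<open>X\<close>, which stays packed, and the single item \<open>i\<close>.\<close>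
      moreover have "f (X \<union> {i}) + f (X \<inter> {i}) \<le> f X + f {i}"
        by (rule I(4)[unfolded submodular_on_def, rule_format]) (use i 2(6,7) in auto)
      moreover have "X \<inter> {i} = {}"
        using \<open>i \<notin> X\<close> by blast
      moreover have "f X \<le> f (run s C X r)"
      proof -
        have "run s C X r \<subseteq> X \<union> (R - {i})"
          by (rule run_subset[OF greedy_tree_adaptive_policy[OF 2(3)]])
        with 2(6,7) have "run s C X r \<subseteq> I" by blast
        then show ?thesis
          using I(3) run_superset[of X s C r] by (auto simp: mono_on_def)
      qed
      ultimately have "f T - f T / exp 1 \<le> f (run s C X r) + f {i}"
        using I(5) by simp
      then have "(1 - 1 / exp 1) * f T \<le> f (run s C X r) + f {i}"
        by (simp add: left_diff_distrib)
      then show ?thesis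
        using True nofit by auto
    next
      \<comment> \<open>Discarding an item outside \<open>T\<close> changes neither the content nor
        the inclusion of \<open>T\<close>, so the invariant persists.\<close>
      case False
      have "T \<subseteq> run s C X r
          \<or> (\<exists>j\<in>T. (1 - 1 / exp 1) * f T \<le> f (run s C X r) + f {j})"
        by (rule 2(5)) (use 2(6-) False in auto)
      with nofit show ?thesis by simp
    qed
  qed
qed

section \<open>The value greedy and single items\<close>

text \<open>With empty content, comparing marginals means comparing singleton values. An item that
  does not fit differs from \<open>k\<close>, so \<open>k\<close> remains a competitor until
  something is packed.\<close>

lemma value_greedy_run:
  assumes "mono_on (Pow I) f" "R \<subseteq> I" "k \<in> R" "real (s k) \<le> C"
    and "greedy_tree (\<lambda>X i. f (X \<union> {i}) - f X) X R t" "X = {}"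
  shows "f {k} \<le> f (run s C X t)"
  using assms(5,6,2-4)
proof (induction rule: greedy_tree.induct)
  case (1 X)
  then show ?case by simp
next
  case (2 X R i l r)
  have i: "i \<in> R" "f {k} \<le> f {i}"
    using 2(1) \<open>X = {}\<close> \<open>k \<in> R\<close> by (auto simp: is_arg_max_linorder)
  show ?case
  proof (cases "real (s i) \<le> C")
    case True
    have "run s C {i} l \<subseteq> {i} \<union> (R - {i})"
      using 2(2) \<open>X = {}\<close> by (intro run_subset greedy_tree_adaptive_policy) auto
    then have "run s C {i} l \<subseteq> I"
      using i \<open>R \<subseteq> I\<close> by blast
    then have "f {i} \<le> f (run s C {i} l)"
      using run_superset[of "{i}" s C l] by (intro mono_onD[OF assms(1)]) auto
    then show ?thesis
      using True i \<open>X = {}\<close> by simp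
  next
    case False
    have "f {k} \<le> f (run s C X r)"
      by (rule 2(5)) (use 2(6-) False in auto)
    then show ?thesis
      using False \<open>X = {}\<close> by simp
  qed
qed

section \<open>Combining the two policies\<close>

lemma greedy_pair_bound:
  fixes s :: "'a \<Rightarrow> nat"
  assumes I: "finite I" "\<forall>i\<in>I. 0 < s i" "mono_on (Pow I) f" "submodular_on I f" "f {} = 0"
    and nonneg: "\<forall>X\<subseteq>I. 0 \<le> f X"
    and P: "policy1 I {} s f P1" "policy2 I f P2"
    and T: "T \<subseteq> I" "real (sum s T) \<le> C"
  shows "(1 - 1 / exp 1) * f T \<le> f (run s C {} P1) + f (run s C {} P2)"
proof -
  have t1: "greedy_tree (\<lambda>X i. (f (X \<union> {i}) - f X) / real (s i)) {} I P1"
    and t2: "greedy_tree (\<lambda>X i. f (X \<union> {i}) - f X) {} I P2"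
    using P by (simp_all add: policy1_def policy2_def)
  have sub: "run s C {} P1 \<subseteq> I" "run s C {} P2 \<subseteq> I"
    using run_subset[OF greedy_tree_adaptive_policy[OF t1], of s C "{}"]
      run_subset[OF greedy_tree_adaptive_policy[OF t2], of s C "{}"] by auto
  have size_le: "real (s k) \<le> C" if "k \<in> T" for k
  proof -
    have "s k \<le> sum s T"
      using that finite_subset[OF T(1) I(1)] by (intro member_le_sum) auto
    then show ?thesis using T(2) by linarith
  qed
  show ?thesis
  \<comment> \<open>A nonempty feasible \<open>T\<close> forces \<open>C\<close> to be positive, as
    the exponent with denominator \<open>C\<close> requires.\<close>
  proof (cases "T = {}")
    case True
    then show ?thesis
      using I(5) nonneg sub by simp
  next
    case False
    then obtain k where k: "k \<in> T" by blast
    then have "0 < s k"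
      using I(2) T(1) by blast
    then have C: "0 < C"
      using size_le[OF k] by linarith
    have fT: "0 \<le> f T"
      using nonneg T(1) by blast
    \<comment> \<open>At empty content the invariant reads \<open>f T\<close> \<le> exp 0 *
      \<open>f T\<close>, because \<open>f {} = 0\<close>.\<close>
    have "T \<subseteq> run s C {} P1 \<or> (\<exists>i\<in>T. (1 - 1 / exp 1) * f T \<le> f (run s C {} P1) + f {i})"
      by (rule density_greedy_run[OF I C T(2) fT t1]) (use T I(5) in auto)
    then show ?thesis
    proof (elim disjE bexE)
      assume "T \<subseteq> run s C {} P1"
      then have "f T \<le> f (run s C {} P1)"
        using I(3) sub(1) by (auto simp: mono_on_def)
      moreover have "(1 - 1 / exp 1) * f T \<le> f T"
        using fT by (simp add: algebra_simps)
      moreover have "0 \<le> f (run s C {} P2)"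
        using nonneg sub(2) by blast
      ultimately show ?thesis by linarith
    next
      fix i assume i: "i \<in> T" "(1 - 1 / exp 1) * f T \<le> f (run s C {} P1) + f {i}"
      have "f {i} \<le> f (run s C {} P2)"
        by (rule value_greedy_run[OF I(3) _ _ _ t2]) (use i(1) T(1) size_le in auto)
      with i(2) show ?thesis by linarith
    qed
  qed
qed

text \<open>The first seven terms of the series sum to 1957/720, just above 2.718; the bound 0.316
  needs e > 1/0.368, about 2.7174.\<close>

lemma exp_1_gt: "2.718 < exp (1 :: real)"
proof -
  have "(\<Sum>n<7. inverse (fact n) *\<^sub>R (1::real) ^ n) \<le> exp 1"
    unfolding exp_def by (rule sum_le_suminf[OF summable_exp_generic]) auto
  then show ?thesis
    by (simp add: fact_numeral lessThan_nat_numeral)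
qed

theorem theorem2:
  fixes I :: "'a set" and s :: "'a \<Rightarrow> nat" and f :: "'a set \<Rightarrow> real"
    and P1 P2 :: "'a policy"
  assumes "finite I"
    and "\<forall>i\<in>I. 0 < s i"
    and "\<forall>X\<subseteq>I. 0 \<le> f X"
    and "mono_on (Pow I) f"
    and "submodular_on I f"
    and "f {} = 0"
    and "policy1 I {} s f P1"
    and "policy2 I f P2"
  shows "randomized_policy I (coin_mix P1 P2)
    \<and> robust I s f (1/2 * (1 - 1 / exp 1)) (coin_mix P1 P2)
    \<and> (\<forall>C\<ge>0. (f (run s C {} P1) + f (run s C {} P2)) / 2
              \<ge> 1/2 * (1 - 1 / exp 1) * f (OPT I s f C))
    \<and> 1/2 * (1 - 1 / exp 1) > (0.316 :: real)"
proof -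
  have "adaptive_policy I P1" "adaptive_policy I P2"
    using assms(7,8) by (auto simp: policy1_def policy2_def dest: greedy_tree_adaptive_policy)
  then have "randomized_policy I (coin_mix P1 P2)"
    by (auto simp: randomized_policy_def coin_mix_def)
  moreover have bound: "\<forall>C\<ge>0. (f (run s C {} P1) + f (run s C {} P2)) / 2
              \<ge> 1/2 * (1 - 1 / exp 1) * f (OPT I s f C)"
  proof (intro allI impI)
    fix C :: real assume "0 \<le> C"
    \<comment> \<open>For nonnegative \<open>C\<close> the empty set is feasible, so the choice in
      \<open>OPT\<close> yields a genuine maximizer.\<close>
    have "OPT I s f C \<subseteq> I" "real (sum s (OPT I s f C)) \<le> C"
      using OPT_is_arg_max[OF assms(1) \<open>0 \<le> C\<close>, of f s] by (auto simp: is_arg_max_def)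
    then show "(f (run s C {} P1) + f (run s C {} P2)) / 2
              \<ge> 1/2 * (1 - 1 / exp 1) * f (OPT I s f C)"
      using greedy_pair_bound[OF assms(1,2,4-6,3,7,8)] by simp
  qed
  moreover have "measure_pmf.expectation (coin_mix P1 P2) (\<lambda>t. f (run s C {} t))
      = (f (run s C {} P1) + f (run s C {} P2)) / 2" for C
    by (simp add: coin_mix_def field_simps)
  with bound have "robust I s f (1/2 * (1 - 1 / exp 1)) (coin_mix P1 P2)"
    by (simp add: robust_def)
  moreover have "1/2 * (1 - 1 / exp 1) > (0.316 :: real)"
    using exp_1_gt by (simp add: field_simps)
  ultimately show ?thesis by blast
qed

end
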